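(* Let $Q\in\mathbb R^{n\times l}$, $1\le l\le n$, be a matrix with orthonormal columns such that $Q^T$ is full spark. Let $\theta\ne\tilde\theta$ in $\mathbb R^{1\times n}$ be (corresponding) rows of a single weight matrix, and put $\delta=\tilde\theta-\theta$. If $\delta Q=0$ and $\delta\ne 0$, then $\|\delta\|_0\ge l+1$.
   Context: $Q^T$ is full spark if every set of $l$ columns of $Q^T$ (equivalently, every set of $l$ rows of $Q$) is linearly independent. $\|\delta\|_0$ is the number of nonzero coordinates of $\delta$. *)

theory Defs
  imports "HOL-Analysis.Analysis"
begin

definition orthonormal_columns :: "real^'l^'n \<Rightarrow> bool" where
  "orthonormal_columns Q \<longleftrightarrow>
     (\<forall>i j. column i Q \<bullet> column j Q = (if i = j then 1 else 0))"

text \<open>Linear independence of the columns is meant as a family: the injectivity conjunct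
  excludes repeated columns, which the image set alone would not see.\<close>

definition full_spark :: "real^'n^'l \<Rightarrow> bool" where
  "full_spark A \<longleftrightarrow>
     (\<forall>S :: 'n set. card S = CARD('l) \<longrightarrow>
        inj_on (\<lambda>j. column j A) S \<and> independent ((\<lambda>j. column j A) ` S))"

definition l0_norm :: "real^'n \<Rightarrow> nat" where
  "l0_norm v = card {j. v $ j \<noteq> 0}"

end

theory Submission
  imports Defs
begin

text \<open>The equation \<open>\<delta> v* Q = 0\<close> is a linear relation among the columns of
  \<open>transpose Q\<close>, with the entries of \<open>\<delta>\<close> as coefficients. If at
  most l of them were nonzero, the relation would live on l columns, which full spark makes
  independent; so all coefficients would vanish, against \<open>\<delta> \<noteq> 0\<close>.\<close>

lemma full_spark_kernel_l0_norm:
  fixes A :: "real^'n^'l"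
  assumes spark: "full_spark A" and le: "CARD('l) \<le> CARD('n)"
    and ker: "A *v x = 0" and nz: "x \<noteq> 0"
  shows "CARD('l) < l0_norm x"
proof (rule ccontr)
  assume "\<not> CARD('l) < l0_norm x"
  then have "card {j. x $ j \<noteq> 0} \<le> CARD('l)"
    by (simp add: l0_norm_def)
  \<comment> \<open>Full spark speaks only of sets of exactly l columns, so the support is padded to
    that size; \<open>le\<close> leaves room for this.\<close>
  then obtain S where S: "{j. x $ j \<noteq> 0} \<subseteq> S" "card S = CARD('l)"
    using exists_subset_between[of "{j. x $ j \<noteq> 0}" "CARD('l)" UNIV] le by auto
  define c where "c = (\<lambda>j. column j A)"
  have inj: "inj_on c S" and ind: "independent (c ` S)"
    using spark S(2) by (auto simp: full_spark_def c_def)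
  \<comment> \<open>Independence concerns sets of vectors, so coefficients must be functions of the
    column itself; injectivity of \<open>c\<close> on \<open>S\<close> recovers the index.\<close>
  have "(\<Sum>v\<in>c ` S. x $ the_inv_into S c v *\<^sub>R v) = (\<Sum>j\<in>S. x $ j *\<^sub>R c j)"
    by (simp add: sum.reindex[OF inj] the_inv_into_f_f[OF inj])
  also have "\<dots> = (\<Sum>j\<in>UNIV. x $ j *\<^sub>R c j)"
    using S(1) by (intro sum.mono_neutral_left) auto
  also have "\<dots> = A *v x"
    by (simp add: matrix_mult_sum c_def scalar_mult_eq_scaleR)
  finally have sum0: "(\<Sum>v\<in>c ` S. x $ the_inv_into S c v *\<^sub>R v) = 0"
    using ker by simp
  have "x $ j = 0" if "j \<in> S" for j
    using independentD[OF ind _ order_refl sum0, of "c j"] that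
    by (simp add: the_inv_into_f_f[OF inj])
  with S(1) have "x = 0"
    by (auto simp: vec_eq_iff)
  with nz show False ..
qed

theorem lemmaE8:
  fixes Q :: "real^'l^'n"
    and \<theta> \<theta>' \<delta> :: "real^'n"
  assumes "1 \<le> CARD('l)" and "CARD('l) \<le> CARD('n)"
    and "orthonormal_columns Q"
    and "full_spark (transpose Q)"
    and "\<theta> \<noteq> \<theta>'"
    and "\<delta> = \<theta>' - \<theta>"
    and "\<delta> v* Q = 0"
    and "\<delta> \<noteq> 0"
  shows "l0_norm \<delta> \<ge> CARD('l) + 1"
  \<comment> \<open>A row vector times \<open>Q\<close> is \<open>transpose Q\<close> times the same
    vector.\<close>
  using full_spark_kernel_l0_norm[of "transpose Q" \<delta>] assms by simp

end
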